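(* Let $a>1$ be odd, $k=2a$, and $n=(2a+2)\left\lfloor\frac{a-1}{4}\right\rfloor$. Define $f:\{0,1,\ldots,n-1\}\to\{-1,1\}$ by $f(j)=-1$ if $j\bmod a<\frac{a-1}{2}$ and $f(j)=1$ if $j\bmod a\ge\frac{a-1}{2}$ (where $j\bmod a\in\{0,\ldots,a-1\}$). Let $A\subseteq\{0,1,\ldots,n-1\}$ be any $k$-term arithmetic progression with positive common difference $d$. Then $\sum_{j\in A}f(j)\ne0$, and moreover $\left|\sum_{j\in A}f(j)\right|\ge\gcd(d,k)$. *)

theory Defs
  imports Complex_Main
begin

text \<open>
  A is an arithmetic progression of \<open>k\<close> terms with common difference \<open>d\<close>. For \<open>d > 0\<close> the \<open>k\<close>
  terms are pairwise distinct, so that \<open>card A = k\<close>.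
\<close>
definition arith_prog :: "nat \<Rightarrow> nat \<Rightarrow> nat set \<Rightarrow> bool" where
  "arith_prog k d A \<longleftrightarrow> (\<exists>b. A = (\<lambda>i. b + i * d) ` {..<k})"

end

theory Submission
  imports Defs
begin

text \<open>
  Put \<open>g = gcd d a\<close>. Since \<open>f j\<close> depends only on \<open>j mod a\<close>, the values of \<open>f\<close> along the progression
  have period \<open>a div g\<close>, so the \<open>2 * a\<close> terms split into \<open>2 * g\<close> blocks with equal sums. A block
  consists of an odd number of values \<open>\<plusminus>1\<close>, hence its sum is odd, and the total is at
  least \<open>2 * g \<ge> gcd d (2 * a)\<close> in absolute value.
\<close>

lemma sum_lessThan_mult_periodic:
  fixes h :: "nat \<Rightarrow> 'a::comm_semiring_1"
  assumes "\<And>i. h (i + m) = h i"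
  shows "(\<Sum>i<c * m. h i) = of_nat c * (\<Sum>i<m. h i)"
proof -
  have shift: "h (i + j * m) = h i" for i j
  proof (induction j)
    case (Suc j)
    have "h (i + Suc j * m) = h ((i + j * m) + m)"
      by (simp add: algebra_simps)
    with Suc assms show ?case by simp
  qed simp
  \<comment> \<open>Translating the block by \<open>j * m\<close> changes no value, by
    \<open>shift\<close>; \<open>sum.nat_group\<close> then adds up the \<open>c\<close>
    blocks.\<close>
  have "sum h {j * m..<j * m + m} = (\<Sum>i<m. h i)" for j
    using sum.shift_bounds_nat_ivl[of h 0 "j * m" m]
    by (simp add: shift add.commute lessThan_atLeast0)
  then show ?thesis
    using sum.nat_group[of h m c] by simp
qed

lemma odd_sum_odd:
  fixes h :: "'b \<Rightarrow> 'a::ring_parity"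
  assumes "odd (card S)" and "\<And>i. i \<in> S \<Longrightarrow> odd (h i)"
  shows "odd (sum h S)"
proof -
  have "finite S"
    using assms(1) by (metis card.infinite even_zero)
  moreover have "{i \<in> S. odd (h i)} = S"
    using assms(2) by blast
  ultimately show ?thesis
    using assms(1) by (simp add: even_sum_iff)
qed

lemma abs_sum_arith_prog_ge:
  fixes F :: "nat \<Rightarrow> int"
  assumes "odd a" and odd_F: "\<And>j. odd (F j)" and mod_F: "\<And>j. F (j mod a) = F j"
  shows "2 * int (gcd d a) \<le> \<bar>\<Sum>i<2 * a. F (b + i * d)\<bar>"
proof -
  define g where "g = gcd d a"
  define m where "m = a div g"
  have a: "a = g * m"
    unfolding m_def g_def by (metis dvd_mult_div_cancel gcd_dvd2)
  have "g dvd d"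
    by (simp add: g_def)
  \<comment> \<open>As \<open>a = g * m\<close> and \<open>g\<close> divides \<open>d\<close>, going
    \<open>m\<close> terms along the progression preserves residues mod \<open>a\<close>.\<close>
  then have "a dvd m * d"
    by (subst a) (simp add: mult.commute mult_dvd_mono)
  then obtain e where e: "m * d = e * a"
    by (metis dvdE mult.commute)
  have per: "F (b + (i + m) * d) = F (b + i * d)" for i
  proof -
    have "b + (i + m) * d = (b + i * d) + e * a"
      by (simp add: add_mult_distrib e)
    then have "(b + (i + m) * d) mod a = (b + i * d) mod a"
      by (simp only: mod_mult_self1)
    then show ?thesis
      by (metis mod_F)
  qed
  define s where "s = (\<Sum>i<m. F (b + i * d))"
  \<comment> \<open>\<open>m\<close> divides the odd number \<open>a\<close>. An odd
    \<open>s\<close> cannot vanish, which gives the bound 1.\<close>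
  have "odd m"
    using \<open>odd a\<close> a by (metis even_mult_iff)
  then have "odd s"
    unfolding s_def by (intro odd_sum_odd) (simp_all add: odd_F)
  then have "1 \<le> \<bar>s\<bar>"
    by (cases "s = 0") auto
  have "2 * a = 2 * g * m"
    using a by simp
  then have "(\<Sum>i<2 * a. F (b + i * d)) = 2 * int g * s"
    using sum_lessThan_mult_periodic[of "\<lambda>i. F (b + i * d)" m "2 * g"] per
    by (simp add: s_def mult.assoc)
  then show ?thesis
    using \<open>1 \<le> \<bar>s\<bar>\<close> mult_left_mono[of 1 "\<bar>s\<bar>" "2 * int g"]
    by (simp add: abs_mult g_def)
qed

theorem theorem3p6:
  fixes a k n d :: nat and f :: "nat \<Rightarrow> int" and A :: "nat set"
  assumes "a > 1" and "odd a"
    and "k = 2 * a"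
    and "n = (2 * a + 2) * nat \<lfloor>(real a - 1) / 4\<rfloor>"
    and "\<And>j. j < n \<Longrightarrow> real (j mod a) < (real a - 1) / 2 \<Longrightarrow> f j = -1"
    and "\<And>j. j < n \<Longrightarrow> real (j mod a) \<ge> (real a - 1) / 2 \<Longrightarrow> f j = 1"
    and "d > 0" and "arith_prog k d A" and "A \<subseteq> {..<n}"
  shows "(\<Sum>j\<in>A. f j) \<noteq> 0 \<and> \<bar>\<Sum>j\<in>A. f j\<bar> \<ge> int (gcd d k)"
proof -
  \<comment> \<open>The values of \<open>f\<close> are prescribed only below \<open>n\<close>;
    \<open>F\<close> continues the same rule to all naturals, so that oddness and periodicity hold
    everywhere.\<close>
  define F :: "nat \<Rightarrow> int" where "F j = (if real (j mod a) < (real a - 1) / 2 then -1 else 1)" for j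
  obtain b where A: "A = (\<lambda>i. b + i * d) ` {..<k}"
    using assms(8) unfolding arith_prog_def by blast
  have "(\<Sum>j\<in>A. f j) = (\<Sum>j\<in>A. F j)"
    using assms(5,6,9) by (intro sum.cong) (auto simp: F_def)
  also have "\<dots> = (\<Sum>i<2 * a. F (b + i * d))"
    \<comment> \<open>A positive \<open>d\<close> makes the indexing injective.\<close>
    unfolding A using \<open>d > 0\<close> \<open>k = 2 * a\<close>
    by (subst sum.reindex) (auto simp: inj_on_def)
  finally have "2 * int (gcd d a) \<le> \<bar>\<Sum>j\<in>A. f j\<bar>"
    using abs_sum_arith_prog_ge[OF \<open>odd a\<close>, of F d b] by (simp add: F_def)
  moreover have pos: "gcd d a > 0"
    using \<open>d > 0\<close> by simp
  \<comment> \<open>Doubling \<open>d\<close> can only enlarge the gcd with \<open>2 * a\<close>,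
    and then the factor 2 comes out.\<close>
  moreover have "gcd d k \<le> 2 * gcd d a"
  proof (rule dvd_imp_le)
    have "gcd d k dvd gcd (2 * d) (2 * a)"
      using \<open>k = 2 * a\<close> by (simp add: gcd_dvdI1)
    then show "gcd d k dvd 2 * gcd d a"
      by (simp add: gcd_mult_distrib_nat)
  qed (use pos in simp)
  \<comment> \<open>Nonvanishing follows because the lower bound \<open>2 * gcd d a\<close> is
    positive.\<close>
  ultimately show ?thesis
    by (auto simp flip: of_nat_le_iff)
qed

end
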